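(* Let $I\subseteq\mathbb{R}$ be a nonempty open interval, let $M\in\mathcal{M}(I)$, and let $\Phi:I\to\mathbb{R}$ be a continuous, strictly monotone function such that $$M(x,y)=\mathscr{A}_\Phi\big(M(x,M(x,y)),\,M(M(x,y),y)\big)\qquad\text{for all }x,y\in I.$$ Then $M$ enjoys the balancing property if and only if $M$ is the quasi-arithmetic mean generated by $\Phi$, that is, $M=\mathscr{A}_\Phi$ on $I\times I$.
   Context: A mean on $I$ is a function $M:I\times I\to\mathbb{R}$ with $\min(x,y)\le M(x,y)\le\max(x,y)$ for all $x,y\in I$ (so $M$ takes values in $I$). $M$ is strictly monotone if for all fixed $x_0,y_0\in I$ the functions $x\mapsto M(x,y_0)$ and $y\mapsto M(x_0,y)$ are strictly increasing on $I$. For a continuous, strictly monotone function $\Phi:I\to\mathbb{R}$, the quasi-arithmetic mean generated by $\Phi$ is $\mathscr{A}_\Phi(x,y):=\Phi^{-1}\big(\tfrac{\Phi(x)+\Phi(y)}{2}\big)$, $x,y\in I$. The class $\mathcal{M}(I)$ consists of all means $M:I\times I\to\mathbb{R}$ that are continuous, strictly monotone, and for which there exists a continuous, strictly monotone function $\Phi:I\to\mathbb{R}$ with $M(x,y)=\mathscr{A}_\Phi\big(M(x,M(x,y)),M(M(x,y),y)\big)$ for all $x,y\in I$. A mean $M$ on $I$ has the balancing property (is balanced) if $M\big(M(x,M(x,y)),M(M(x,y),y)\big)=M(x,y)$ for all $x,y\in I$. *)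

theory Defs
  imports "HOL-Analysis.Analysis"
begin

text \<open>
  Means on \<open>I\<close> are represented by total functions on the reals; every notion
  below only looks at arguments in \<open>I\<close>.
\<close>

definition mean_on :: "real set \<Rightarrow> (real \<Rightarrow> real \<Rightarrow> real) \<Rightarrow> bool" where
  "mean_on I M \<longleftrightarrow> (\<forall>x\<in>I. \<forall>y\<in>I. min x y \<le> M x y \<and> M x y \<le> max x y)"

definition strictly_monotone_mean_on :: "real set \<Rightarrow> (real \<Rightarrow> real \<Rightarrow> real) \<Rightarrow> bool" where
  "strictly_monotone_mean_on I M \<longleftrightarrow>
     (\<forall>y0\<in>I. strict_mono_on I (\<lambda>x. M x y0)) \<and> (\<forall>x0\<in>I. strict_mono_on I (\<lambda>y. M x0 y))"

text \<open>Strict monotonicity of a generator allows increasing and decreasing functions.\<close>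

definition generator_on :: "real set \<Rightarrow> (real \<Rightarrow> real) \<Rightarrow> bool" where
  "generator_on I \<Phi> \<longleftrightarrow>
     continuous_on I \<Phi> \<and> (strict_mono_on I \<Phi> \<or> strict_antimono_on I \<Phi>)"

text \<open>
  For a generator \<open>\<Phi>\<close> on an interval \<open>I\<close>, the midpoint of \<open>\<Phi> x\<close> and \<open>\<Phi> y\<close> lies in
  \<open>\<Phi> ` I\<close>, so \<^const>\<open>inv_into\<close> is applied to a point where it is the genuine inverse.
\<close>

definition quasi_arith_mean :: "real set \<Rightarrow> (real \<Rightarrow> real) \<Rightarrow> real \<Rightarrow> real \<Rightarrow> real" where
  "quasi_arith_mean I \<Phi> x y = inv_into I \<Phi> ((\<Phi> x + \<Phi> y) / 2)"

definition gen_balanced_on ::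
    "real set \<Rightarrow> (real \<Rightarrow> real) \<Rightarrow> (real \<Rightarrow> real \<Rightarrow> real) \<Rightarrow> bool" where
  "gen_balanced_on I \<Phi> M \<longleftrightarrow>
     (\<forall>x\<in>I. \<forall>y\<in>I. M x y = quasi_arith_mean I \<Phi> (M x (M x y)) (M (M x y) y))"

definition mean_class :: "real set \<Rightarrow> (real \<Rightarrow> real \<Rightarrow> real) set" where
  "mean_class I = {M. mean_on I M \<and> continuous_on (I \<times> I) (\<lambda>(x, y). M x y) \<and>
     strictly_monotone_mean_on I M \<and> (\<exists>\<Phi>. generator_on I \<Phi> \<and> gen_balanced_on I \<Phi> M)}"

definition balanced_on :: "real set \<Rightarrow> (real \<Rightarrow> real \<Rightarrow> real) \<Rightarrow> bool" where
  "balanced_on I M \<longleftrightarrow> (\<forall>x\<in>I. \<forall>y\<in>I. M (M x (M x y)) (M (M x y) y) = M x y)"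

end

theory Submission
  imports Defs
begin

text \<open>
  Call a pair \<open>(x, y)\<close> \<^emph>\<open>arithmetic\<close> if \<open>2 * \<Phi> (M x y) = \<Phi> x + \<Phi> y\<close>; since \<open>\<Phi>\<close> is injective,
  this says that \<open>M\<close> agrees with the quasi-arithmetic mean of \<open>\<Phi>\<close> at \<open>(x, y)\<close>.  If all pairs are
  arithmetic, then balancing is the functional equation of \<open>M\<close> with the quasi-arithmetic mean of
  \<open>M x m\<close> and \<open>M m y\<close>, where \<open>m = M x y\<close>, rewritten as \<open>M (M x m) (M m y)\<close>.

  The converse rests on two observations about a balanced \<open>M\<close>.

  \<^item> Balancing turns the functional equation into a source of arithmetic pairs: if \<open>M s t = m\<close>,
    then \<open>p = M s m\<close> and \<open>q = M m t\<close> satisfy \<open>M p q = m\<close> and \<open>\<Phi> p + \<Phi> q = 2 * \<Phi> m\<close>.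
    Near the diagonal, the intermediate value theorem yields every pair \<open>p \<le> q\<close> in this way, so
    arithmetic pairs fill a neighbourhood of each diagonal point
    (\<open>eventually_arithmetic_near_diagonal\<close>).

  \<^item> The functional equation makes arithmeticity propagate outwards: if \<open>(x, m)\<close> and \<open>(m, y)\<close> are
    arithmetic for \<open>m = M x y\<close>, then so is \<open>(x, y)\<close> (\<open>arithmetic_if_halves\<close>).

  If a pair \<open>x0 \<le> y0\<close> failed to be arithmetic, compactness would give, among all limits of
  non-arithmetic ordered pairs in \<open>[x0, y0]\<close>, one pair \<open>(u, v)\<close> with \<open>v - u\<close> minimal.  It is not
  diagonal by the first observation.  If \<open>u < v\<close>, then \<open>M u v\<close> lies strictly between, so for every
  \<open>(x, y)\<close> near \<open>(u, v)\<close> both halves \<open>(x, M x y)\<close> and \<open>(M x y, y)\<close> are shorter than \<open>v - u\<close>,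
  hence arithmetic, and the second observation shows that \<open>(x, y)\<close> is arithmetic: a contradiction.
  Pairs \<open>x > y\<close> are covered by exchanging the two arguments of \<open>M\<close>, which preserves all hypotheses.
\<close>

section \<open>Balanced means satisfying the functional equation\<close>

text \<open>
  In the locale the functional equation is stated through \<open>\<Phi>\<close> itself rather than through its inverse, so that it
  is linear in the values of \<open>\<Phi>\<close> and invariant under exchanging the arguments of \<open>M\<close>.
\<close>
locale balanced_generated_mean =
  fixes I :: "real set" and M :: "real \<Rightarrow> real \<Rightarrow> real" and \<Phi> :: "real \<Rightarrow> real"
  assumes open_I: "open I"
    and interval_I: "is_interval I"
    and mean: "mean_on I M"
    and continuous: "continuous_on (I \<times> I) (\<lambda>(x, y). M x y)"
    and strict: "strictly_monotone_mean_on I M"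
    and continuous_generator: "continuous_on I \<Phi>"
    and inj_generator: "inj_on \<Phi> I"
    and generated:
      "\<And>x y. x \<in> I \<Longrightarrow> y \<in> I \<Longrightarrow> 2 * \<Phi> (M x y) = \<Phi> (M x (M x y)) + \<Phi> (M (M x y) y)"
    and balanced: "\<And>x y. x \<in> I \<Longrightarrow> y \<in> I \<Longrightarrow> M (M x (M x y)) (M (M x y) y) = M x y"
begin

definition arithmetic :: "real \<Rightarrow> real \<Rightarrow> bool" where
  "arithmetic x y \<longleftrightarrow> 2 * \<Phi> (M x y) = \<Phi> x + \<Phi> y"

lemma between_in_I: "a \<in> I \<Longrightarrow> b \<in> I \<Longrightarrow> a \<le> x \<Longrightarrow> x \<le> b \<Longrightarrow> x \<in> I"
  using interval_I mem_is_interval_1_I by blast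

lemma segment_subset_I: "a \<in> I \<Longrightarrow> b \<in> I \<Longrightarrow> {a..b} \<subseteq> I"
  using between_in_I by (meson atLeastAtMost_iff subsetI)

lemma mean_bounds: "x \<in> I \<Longrightarrow> y \<in> I \<Longrightarrow> x \<le> y \<Longrightarrow> x \<le> M x y \<and> M x y \<le> y"
  using mean unfolding mean_on_def by (metis max.absorb2 min.absorb1)

lemma mean_idem: "x \<in> I \<Longrightarrow> M x x = x"
  using mean_bounds[of x x] by simp

lemma mean_less_left: "a \<in> I \<Longrightarrow> b \<in> I \<Longrightarrow> y \<in> I \<Longrightarrow> a < b \<Longrightarrow> M a y < M b y"
  using strict unfolding strictly_monotone_mean_on_def by (simp add: monotone_on_def)

lemma mean_less_right: "x \<in> I \<Longrightarrow> a \<in> I \<Longrightarrow> b \<in> I \<Longrightarrow> a < b \<Longrightarrow> M x a < M x b"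
  using strict unfolding strictly_monotone_mean_on_def by (simp add: monotone_on_def)

lemma mean_strictly_between:
  assumes "x \<in> I" "y \<in> I" "x < y"
  shows "x < M x y" "M x y < y"
  using mean_less_right[of x x y] mean_less_left[of x y y] mean_idem assms by simp_all

lemma mean_in_I: "x \<in> I \<Longrightarrow> y \<in> I \<Longrightarrow> x \<le> y \<Longrightarrow> M x y \<in> I"
  using mean_bounds between_in_I by blast

lemma continuous_mean_comp:
  assumes "continuous_on S f" "continuous_on S g" "f ` S \<subseteq> I" "g ` S \<subseteq> I"
  shows "continuous_on S (\<lambda>z. M (f z) (g z))"
proof -
  have "continuous_on S (\<lambda>z. case (f z, g z) of (x, y) \<Rightarrow> M x y)"
    by (rule continuous_on_compose2[OF continuous])
      (use assms in \<open>auto intro!: continuous_intros\<close>)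
  then show ?thesis by simp
qed

lemma mean_tendsto:
  assumes "(f \<longlongrightarrow> a) F" "(g \<longlongrightarrow> b) F" "a \<in> I" "b \<in> I"
  shows "((\<lambda>z. M (f z) (g z)) \<longlongrightarrow> M a b) F"
proof -
  have "isCont (\<lambda>(x, y). M x y) (a, b)"
    using continuous assms(3,4) open_I by (simp add: continuous_on_eq_continuous_at open_Times)
  from isCont_tendsto_compose[OF this tendsto_Pair[OF assms(1,2)]] show ?thesis
    by simp
qed

section \<open>Arithmetic pairs\<close>

lemma arithmetic_if_halves:
  assumes "x \<in> I" "y \<in> I" "arithmetic x (M x y)" "arithmetic (M x y) y"
  shows "arithmetic x y"
  using assms generated[of x y] unfolding arithmetic_def by linarith

text \<open>
  The pair \<open>(x, y)\<close> is realised as \<open>(M s m, M m t)\<close>, where \<open>m\<close> is its quasi-arithmetic mean and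
  \<open>M s t = m\<close>.  The auxiliary bounds \<open>a\<close> and \<open>b\<close> leave enough room for \<open>s\<close> and \<open>t\<close> to exist.
\<close>

lemma arithmetic_if_room:
  assumes ab: "a \<in> I" "b \<in> I" and xy: "x \<in> I" "y \<in> I" "x \<le> y" "a \<le> y"
    and room: "M a y \<le> x" "y \<le> M a b" "a \<le> b"
  shows "arithmetic x y"
proof -
  have bounds: "a \<le> x" "y \<le> b"
    using mean_bounds[of a y] mean_bounds[of a b] assms by auto
  have "continuous_on {x..y} \<Phi>"
    by (rule continuous_on_subset[OF continuous_generator]) (rule segment_subset_I[OF xy(1,2)])
  then have "\<exists>m\<ge>x. m \<le> y \<and> \<Phi> m = (\<Phi> x + \<Phi> y) / 2"
    using xy(3) IVT'[of \<Phi> x "(\<Phi> x + \<Phi> y) / 2" y] IVT2'[of \<Phi> y "(\<Phi> x + \<Phi> y) / 2" x]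
    by (cases "\<Phi> x \<le> \<Phi> y") simp_all
  then obtain m where m: "x \<le> m" "m \<le> y" "2 * \<Phi> m = \<Phi> x + \<Phi> y"
    by fastforce
  have mI: "m \<in> I"
    using between_in_I xy m by blast
  have "M a m \<le> M a y"
    using mean_less_right[of a m y] ab xy mI m by (cases "m = y") auto
  moreover have "continuous_on {a..m} (\<lambda>s. M s m)"
    by (rule continuous_mean_comp[OF continuous_on_id continuous_on_const])
      (use segment_subset_I[OF ab(1) mI] mI in auto)
  ultimately have "\<exists>s\<ge>a. s \<le> m \<and> M s m = x"
    using room(1) m(1,2) bounds mean_idem[OF mI] by (intro IVT') linarith+
  then obtain s where s: "a \<le> s" "s \<le> m" "M s m = x"
    by auto
  have sI: "s \<in> I"
    using between_in_I s ab mI by blast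
  have "M a b \<le> M s b"
    using mean_less_left[of a s b] s ab sI by (cases "a = s") auto
  moreover have "continuous_on {m..b} (\<lambda>t. M s t)"
    by (rule continuous_mean_comp[OF continuous_on_const continuous_on_id])
      (use segment_subset_I[OF mI ab(2)] sI in auto)
  ultimately have "\<exists>t\<ge>m. t \<le> b \<and> M s t = m"
    using room(2) m(1,2) bounds s by (intro IVT') linarith+
  then obtain t where t: "m \<le> t" "t \<le> b" "M s t = m"
    by auto
  have tI: "t \<in> I"
    using between_in_I t ab mI by blast
  have "\<Phi> (M m t) = \<Phi> y"
    using generated[OF sI tI] m(3) unfolding t(3) s(3) by linarith
  then have "M m t = y"
    using inj_generator mean_in_I[OF mI tI t(1)] xy by (simp add: inj_on_eq_iff)
  then have "M x y = m"
    using balanced[OF sI tI] unfolding t(3) s(3) by simp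
  then show ?thesis
    using m by (simp add: arithmetic_def)
qed

text \<open>
  Fixed \<open>a < c < b\<close> serve all pairs near \<open>(c, c)\<close>: by strictness \<open>M a c < c < M a b\<close> once \<open>a\<close> is
  close enough to \<open>c\<close>, and strict inequalities survive small changes of the pair.
\<close>

lemma eventually_arithmetic_near_diagonal:
  assumes "c \<in> I"
  shows "\<forall>\<^sub>F z in nhds (c, c). fst z \<le> snd z \<longrightarrow> arithmetic (fst z) (snd z)"
proof -
  obtain e where e: "e > 0" "ball c e \<subseteq> I"
    using open_I assms openE by blast
  define b where "b = c + e / 2"
  have b: "b \<in> I" "c < b"
    using e by (auto simp: b_def dist_real_def subset_iff)
  have "((\<lambda>a. M a b) \<longlongrightarrow> M c b) (at_left c)"
    by (rule mean_tendsto) (use assms b in simp_all)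
  then have "\<forall>\<^sub>F a in at_left c. c < M a b"
    by (rule order_tendstoD) (use mean_strictly_between assms b in auto)
  moreover have "\<forall>\<^sub>F a in at_left c. a \<in> I"
    using open_I assms by (metis eventually_at_topological)
  moreover have "\<forall>\<^sub>F a in at_left c. a < c"
    by (auto simp: eventually_at_filter)
  ultimately have "\<forall>\<^sub>F a in at_left c. c < M a b \<and> a \<in> I \<and> a < c"
    by eventually_elim auto
  then obtain a where a: "c < M a b" "a \<in> I" "a < c"
    using eventually_happens'[OF trivial_limit_at_left_real] by blast
  have fst_lim: "(fst \<longlongrightarrow> c) (nhds (c, c))" and snd_lim: "(snd \<longlongrightarrow> c) (nhds (c, c))"
    using tendsto_fst[OF filterlim_ident, of "(c, c)"] tendsto_snd[OF filterlim_ident, of "(c, c)"]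
    by (simp_all add: id_def)
  have "((\<lambda>z. fst z - M a (snd z)) \<longlongrightarrow> c - M a c) (nhds (c, c))"
    by (intro tendsto_diff mean_tendsto fst_lim snd_lim tendsto_const a assms)
  then have "\<forall>\<^sub>F z in nhds (c, c). 0 < fst z - M a (snd z)"
    by (rule order_tendstoD) (use mean_strictly_between a assms in auto)
  moreover have "\<forall>\<^sub>F z in nhds (c, c). snd z < M a b"
    using snd_lim a by (auto dest: order_tendstoD)
  moreover have "\<forall>\<^sub>F z in nhds (c, c). a < snd z"
    using snd_lim a by (auto dest: order_tendstoD)
  moreover have "\<forall>\<^sub>F z in nhds (c, c). fst z \<in> I"
    using topological_tendstoD[OF fst_lim open_I] assms by simp
  moreover have "\<forall>\<^sub>F z in nhds (c, c). snd z \<in> I"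
    using topological_tendstoD[OF snd_lim open_I] assms by simp
  ultimately show ?thesis
  proof eventually_elim
    case (elim z)
    then show ?case
      using arithmetic_if_room[of a b "fst z" "snd z"] a b by auto
  qed
qed

text \<open>
  Taking the minimiser \<open>w\<close> in the closure of the set \<open>B\<close> of non-arithmetic pairs makes it irrelevant
  whether \<open>w\<close> itself is arithmetic: it suffices that some neighbourhood of \<open>w\<close> misses \<open>B\<close>.
\<close>

lemma arithmetic_ordered:
  assumes "x0 \<in> I" "y0 \<in> I" "x0 \<le> y0"
  shows "arithmetic x0 y0"
proof (rule ccontr)
  assume bad: "\<not> arithmetic x0 y0"
  define K where "K = {z \<in> {x0..y0} \<times> {x0..y0}. fst z \<le> snd z}"
  define B where "B = {z \<in> K. \<not> arithmetic (fst z) (snd z)}"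
  have K_I: "fst z \<in> I" "snd z \<in> I" if "z \<in> K" for z
    using that segment_subset_I[OF assms(1,2)] by (auto simp: K_def)
  have K_eq: "K = ({x0..y0} \<times> {x0..y0}) \<inter> {z. fst z \<le> snd z}"
    by (auto simp: K_def)
  have "compact K"
    unfolding K_eq
    by (intro compact_Int_closed compact_Times closed_Collect_le continuous_intros) auto
  then have sub: "closure B \<subseteq> K"
    by (intro closure_minimal compact_imp_closed) (simp_all add: B_def)
  have "compact (closure B)"
    using compact_Int_closed[OF \<open>compact K\<close> closed_closure[of B]] sub by (simp add: Int_absorb1)
  moreover have "(x0, y0) \<in> B"
    using bad assms by (simp add: B_def K_def)
  then have "closure B \<noteq> {}"
    by auto
  moreover have "continuous_on (closure B) (\<lambda>z. snd z - fst z)"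
    by (intro continuous_intros)
  ultimately obtain w where w: "w \<in> closure B"
    and least: "\<And>z. z \<in> closure B \<Longrightarrow> snd w - fst w \<le> snd z - fst z"
    using continuous_attains_inf[of "closure B" "\<lambda>z. snd z - fst z"] by blast
  obtain u v where uv: "w = (u, v)"
    by (cases w)
  have uvK: "u \<in> I" "v \<in> I" "u \<le> v"
    using sub w K_I[of w] by (auto simp: uv K_def)
  have shorter: "arithmetic x y" if "(x, y) \<in> K" "y - x < v - u" for x y
  proof (rule ccontr)
    assume "\<not> arithmetic x y"
    then have "(x, y) \<in> closure B"
      using that closure_subset[of B] by (auto simp: B_def)
    then show False
      using least[of "(x, y)"] that(2) by (simp add: uv)
  qed
  have "\<forall>\<^sub>F z in nhds w. z \<notin> B"
  proof (cases "u = v")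
    case True
    from eventually_arithmetic_near_diagonal[OF uvK(1)] show ?thesis
      unfolding uv True[symmetric] by eventually_elim (auto simp: B_def K_def)
  next
    case False
    have fst_lim: "(fst \<longlongrightarrow> u) (nhds w)" and snd_lim: "(snd \<longlongrightarrow> v) (nhds w)"
      using tendsto_fst[OF filterlim_ident, of "(u, v)"] tendsto_snd[OF filterlim_ident, of "(u, v)"]
      by (simp_all add: id_def uv)
    have "((\<lambda>z. M (fst z) (snd z) - fst z) \<longlongrightarrow> M u v - u) (nhds w)"
      by (intro tendsto_diff mean_tendsto fst_lim snd_lim uvK)
    then have "\<forall>\<^sub>F z in nhds w. M (fst z) (snd z) - fst z < v - u"
      by (rule order_tendstoD) (use mean_strictly_between uvK False in auto)
    moreover have "((\<lambda>z. snd z - M (fst z) (snd z)) \<longlongrightarrow> v - M u v) (nhds w)"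
      by (intro tendsto_diff mean_tendsto fst_lim snd_lim uvK)
    then have "\<forall>\<^sub>F z in nhds w. snd z - M (fst z) (snd z) < v - u"
      by (rule order_tendstoD) (use mean_strictly_between uvK False in auto)
    ultimately show ?thesis
    proof eventually_elim
      case (elim z)
      show ?case
      proof
        assume "z \<in> B"
        then have z: "z \<in> K" "\<not> arithmetic (fst z) (snd z)"
          by (auto simp: B_def)
        define m where "m = M (fst z) (snd z)"
        have "fst z \<le> m" "m \<le> snd z"
          using mean_bounds K_I[OF z(1)] z(1) by (auto simp: K_def m_def)
        then have "(fst z, m) \<in> K" "(m, snd z) \<in> K"
          using z(1) by (auto simp: K_def)
        then have "arithmetic (fst z) m" "arithmetic m (snd z)"
          using shorter elim by (auto simp: m_def)
        then show False
          using arithmetic_if_halves K_I[OF z(1)] z(2) by (auto simp: m_def)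
      qed
    qed
  qed
  then obtain S where "open S" "w \<in> S" "S \<inter> B = {}"
    by (auto simp: eventually_nhds)
  then show False
    using w open_Int_closure_eq_empty by blast
qed

end

lemma balanced_generated_mean_swap:
  assumes "balanced_generated_mean I M \<Phi>"
  shows "balanced_generated_mean I (\<lambda>x y. M y x) \<Phi>"
proof -
  interpret balanced_generated_mean I M \<Phi> by fact
  show ?thesis
  proof
    show "mean_on I (\<lambda>x y. M y x)"
      using mean unfolding mean_on_def by (metis min.commute max.commute)
    have "continuous_on (I \<times> I) (\<lambda>z. M (snd z) (fst z))"
      by (intro continuous_mean_comp continuous_intros) auto
    then show "continuous_on (I \<times> I) (\<lambda>(x, y). M y x)"
      by (simp add: case_prod_beta)
    show "strictly_monotone_mean_on I (\<lambda>x y. M y x)"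
      using strict by (simp add: strictly_monotone_mean_on_def)
  qed (use open_I interval_I continuous_generator inj_generator generated balanced in auto)
qed

lemma (in balanced_generated_mean) arithmetic_everywhere:
  assumes "x \<in> I" "y \<in> I"
  shows "arithmetic x y"
proof (cases "x \<le> y")
  case True
  then show ?thesis using arithmetic_ordered assms by blast
next
  case False
  interpret swap: balanced_generated_mean I "\<lambda>x y. M y x" \<Phi>
    by (rule balanced_generated_mean_swap) unfold_locales
  show ?thesis
    using swap.arithmetic_ordered[of y x] assms False
    by (simp add: arithmetic_def swap.arithmetic_def)
qed

section \<open>Quasi-arithmetic means and the characterisation\<close>

lemma generator_on_inj: "generator_on I \<Phi> \<Longrightarrow> inj_on \<Phi> I"
  unfolding generator_on_def inj_on_def monotone_on_def by (metis less_irrefl linorder_neqE)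

lemma generator_quasi_arith_mean:
  assumes "is_interval I" "generator_on I \<Phi>" "x \<in> I" "y \<in> I"
  shows "quasi_arith_mean I \<Phi> x y \<in> I" "2 * \<Phi> (quasi_arith_mean I \<Phi> x y) = \<Phi> x + \<Phi> y"
proof -
  have "is_interval (\<Phi> ` I)"
    using assms by (simp add: generator_on_def is_interval_connected_1 connected_continuous_image)
  moreover have "min (\<Phi> x) (\<Phi> y) \<in> \<Phi> ` I" "max (\<Phi> x) (\<Phi> y) \<in> \<Phi> ` I"
    using assms by (auto simp: min_def max_def)
  ultimately have "(\<Phi> x + \<Phi> y) / 2 \<in> \<Phi> ` I"
    by (rule mem_is_interval_1_I) (auto simp: min_def max_def)
  then show "quasi_arith_mean I \<Phi> x y \<in> I" "2 * \<Phi> (quasi_arith_mean I \<Phi> x y) = \<Phi> x + \<Phi> y"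
    unfolding quasi_arith_mean_def by (simp_all add: inv_into_into f_inv_into_f)
qed

theorem theorem10:
  fixes I :: "real set" and M :: "real \<Rightarrow> real \<Rightarrow> real" and \<Phi> :: "real \<Rightarrow> real"
  assumes "I \<noteq> {}" and "open I" and "is_interval I"
    and "M \<in> mean_class I"
    and "generator_on I \<Phi>"
    and "\<forall>x\<in>I. \<forall>y\<in>I. M x y = quasi_arith_mean I \<Phi> (M x (M x y)) (M (M x y) y)"
  shows "balanced_on I M \<longleftrightarrow> (\<forall>x\<in>I. \<forall>y\<in>I. M x y = quasi_arith_mean I \<Phi> x y)"
proof -
  have mean: "mean_on I M"
    using assms(4) by (simp add: mean_class_def)
  have in_I: "M x y \<in> I" if "x \<in> I" "y \<in> I" for x y
  proof (rule mem_is_interval_1_I[OF assms(3)])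
    show "min x y \<in> I" "max x y \<in> I"
      using that by (auto simp: min_def max_def)
    show "min x y \<le> M x y" "M x y \<le> max x y"
      using mean that by (auto simp: mean_on_def)
  qed
  show ?thesis
  proof
    assume "balanced_on I M"
    have inj: "inj_on \<Phi> I"
      using generator_on_inj assms(5) .
    interpret balanced_generated_mean I M \<Phi>
    proof
      show "2 * \<Phi> (M x y) = \<Phi> (M x (M x y)) + \<Phi> (M (M x y) y)" if "x \<in> I" "y \<in> I" for x y
        using generator_quasi_arith_mean(2)[OF assms(3,5), of "M x (M x y)" "M (M x y) y"]
          assms(6) in_I that by simp
      show "M (M x (M x y)) (M (M x y) y) = M x y" if "x \<in> I" "y \<in> I" for x y
        using \<open>balanced_on I M\<close> that by (simp add: balanced_on_def)
    qed (use assms mean inj in \<open>auto simp: mean_class_def generator_on_def\<close>)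
    show "\<forall>x\<in>I. \<forall>y\<in>I. M x y = quasi_arith_mean I \<Phi> x y"
    proof (intro ballI)
      fix x y assume xy: "x \<in> I" "y \<in> I"
      have "\<Phi> (M x y) = \<Phi> (quasi_arith_mean I \<Phi> x y)"
        using arithmetic_everywhere[OF xy] generator_quasi_arith_mean(2)[OF assms(3,5) xy]
        by (simp add: arithmetic_def)
      then show "M x y = quasi_arith_mean I \<Phi> x y"
        using inj in_I[OF xy] generator_quasi_arith_mean(1)[OF assms(3,5) xy]
        by (simp add: inj_on_eq_iff)
    qed
  next
    assume "\<forall>x\<in>I. \<forall>y\<in>I. M x y = quasi_arith_mean I \<Phi> x y"
    then show "balanced_on I M"
      unfolding balanced_on_def using assms(6) in_I by metis
  qed
qed

end
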